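(* Let $(A,R)$ be a modified Rota-Baxter algebra of weight $\kappa\in\mathbf{k}$, and let $(M,S)$ be a bimodule over it. Then the pair $(A\oplus M,R\oplus S)$ is a modified Rota-Baxter algebra of weight $\kappa$, where the associative algebra structure on $A\oplus M$ is the semidirect product $$(a,u)\cdot_\ltimes(b,v)=(a\cdot b,\ a\cdot v+u\cdot b),\qquad (a,u),(b,v)\in A\oplus M.$$
   Context: Everything is over a field $\mathbf{k}$ of characteristic $0$; algebras are associative (not necessarily unital). A modified Rota-Baxter algebra of weight $\kappa$ is a pair $(A,R)$ of an algebra $A$ and a linear map $R:A\to A$ with $R(a)\cdot R(b)=R(R(a)\cdot b+a\cdot R(b))+\kappa\,a\cdot b$ for all $a,b\in A$. A bimodule over $(A,R)$ is a pair $(M,S)$ of an $A$-bimodule $M$ and a linear map $S:M\to M$ with $R(a)\cdot S(u)=S(R(a)\cdot u+a\cdot S(u))+\kappa\,a\cdot u$ and $S(u)\cdot R(a)=S(S(u)\cdot a+u\cdot R(a))+\kappa\,u\cdot a$ for all $a\in A$, $u\in M$. $(R\oplus S)(a,u)=(R(a),S(u))$. *)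

theory Defs
  imports "HOL-Analysis.Product_Vector"
begin

text \<open>
  Vector spaces over a field of characteristic 0 are given as in \<^theory>\<open>HOL.Vector_Spaces\<close>: an abelian
  group type together with an explicit scalar multiplication, so the ground field is arbitrary.
  Algebras are not required to have a unit, and bimodules carry no unit condition.
\<close>

definition bilinear_map ::
  "('k::field_char_0 \<Rightarrow> 'a::ab_group_add \<Rightarrow> 'a) \<Rightarrow> ('k \<Rightarrow> 'b::ab_group_add \<Rightarrow> 'b) \<Rightarrow>
   ('k \<Rightarrow> 'c::ab_group_add \<Rightarrow> 'c) \<Rightarrow> ('a \<Rightarrow> 'b \<Rightarrow> 'c) \<Rightarrow> bool"
  where "bilinear_map sA sB sC f \<longleftrightarrow>
    (\<forall>a. Vector_Spaces.linear sB sC (\<lambda>b. f a b)) \<and>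
    (\<forall>b. Vector_Spaces.linear sA sC (\<lambda>a. f a b))"

locale associative_algebra = vector_space scale
  for scale :: "'k::field_char_0 \<Rightarrow> 'a::ab_group_add \<Rightarrow> 'a" +
  fixes mult :: "'a \<Rightarrow> 'a \<Rightarrow> 'a"
  assumes mult_bilinear: "bilinear_map scale scale scale mult"
    and mult_assoc: "mult (mult a b) c = mult a (mult b c)"

locale modified_rota_baxter_algebra = associative_algebra scale mult
  for scale :: "'k::field_char_0 \<Rightarrow> 'a::ab_group_add \<Rightarrow> 'a"
    and mult :: "'a \<Rightarrow> 'a \<Rightarrow> 'a" +
  fixes R :: "'a \<Rightarrow> 'a" and \<kappa> :: 'k
  assumes R_linear: "Vector_Spaces.linear scale scale R"
    and modified_rota_baxter:
      "mult (R a) (R b) = R (mult (R a) b + mult a (R b)) + scale \<kappa> (mult a b)"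

locale algebra_bimodule =
  A: associative_algebra scaleA mult + M: vector_space scaleM
  for scaleA :: "'k::field_char_0 \<Rightarrow> 'a::ab_group_add \<Rightarrow> 'a"
    and mult :: "'a \<Rightarrow> 'a \<Rightarrow> 'a"
    and scaleM :: "'k \<Rightarrow> 'm::ab_group_add \<Rightarrow> 'm" +
  fixes lact :: "'a \<Rightarrow> 'm \<Rightarrow> 'm" and ract :: "'m \<Rightarrow> 'a \<Rightarrow> 'm"
  assumes lact_bilinear: "bilinear_map scaleA scaleM scaleM lact"
    and ract_bilinear: "bilinear_map scaleM scaleA scaleM ract"
    and lact_assoc: "lact (mult a b) u = lact a (lact b u)"
    and ract_assoc: "ract u (mult a b) = ract (ract u a) b"
    and lact_ract: "ract (lact a u) b = lact a (ract u b)"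

locale modified_rota_baxter_bimodule =
  A: modified_rota_baxter_algebra scaleA mult R \<kappa> +
  algebra_bimodule scaleA mult scaleM lact ract
  for scaleA :: "'k::field_char_0 \<Rightarrow> 'a::ab_group_add \<Rightarrow> 'a"
    and mult :: "'a \<Rightarrow> 'a \<Rightarrow> 'a"
    and R :: "'a \<Rightarrow> 'a" and \<kappa> :: 'k
    and scaleM :: "'k \<Rightarrow> 'm::ab_group_add \<Rightarrow> 'm"
    and lact :: "'a \<Rightarrow> 'm \<Rightarrow> 'm" and ract :: "'m \<Rightarrow> 'a \<Rightarrow> 'm" +
  fixes S :: "'m \<Rightarrow> 'm"
  assumes S_linear: "Vector_Spaces.linear scaleM scaleM S"
    and modified_rota_baxter_left:
      "lact (R a) (S u) = S (lact (R a) u + lact a (S u)) + scaleM \<kappa> (lact a u)"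
    and modified_rota_baxter_right:
      "ract (S u) (R a) = S (ract (S u) a + ract u (R a)) + scaleM \<kappa> (ract u a)"

fun semidirect_mult ::
  "('a \<Rightarrow> 'a \<Rightarrow> 'a) \<Rightarrow> ('a \<Rightarrow> 'm \<Rightarrow> 'm) \<Rightarrow> ('m \<Rightarrow> 'a \<Rightarrow> 'm) \<Rightarrow>
   'a \<times> 'm \<Rightarrow> 'a \<times> 'm \<Rightarrow> 'a \<times> 'm::ab_group_add"
  where "semidirect_mult mult lact ract (a, u) (b, v) = (mult a b, lact a v + ract u b)"

end

theory Submission
  imports Defs
begin

text \<open>The product on \<open>'a \<times> 'm\<close> has no term in which two elements of the
  module meet, so each axiom splits into an algebra axiom in the first component and a sum of
  bimodule axioms in the second. For associativity of (a,u), (b,v), (c,w) these are the three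
  bimodule laws, one for each position of the module element. For the Rota-Baxter identity of (a,u),
  (b,v) they are the left identity at a, v plus the right identity at u, b, combined by linearity of
  \<open>S\<close>. Bilinearity is restated as equations so that these expansions become
  rewriting.\<close>

lemma bilinear_map_iff:
  assumes "vector_space sA" "vector_space sB" "vector_space sC"
  shows "bilinear_map sA sB sC f \<longleftrightarrow>
    (\<forall>a b c. f a (b + c) = f a b + f a c) \<and> (\<forall>a b c. f (a + b) c = f a c + f b c) \<and>
    (\<forall>r a b. f a (sB r b) = sC r (f a b)) \<and> (\<forall>r a b. f (sA r a) b = sC r (f a b))"
  using assms unfolding bilinear_map_def Vector_Spaces.linear_iff by blast

theorem proposition2p8:
  fixes scaleA :: "'k::field_char_0 \<Rightarrow> 'a::ab_group_add \<Rightarrow> 'a"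
    and mult :: "'a \<Rightarrow> 'a \<Rightarrow> 'a"
    and R :: "'a \<Rightarrow> 'a"
    and \<kappa> :: 'k
    and scaleM :: "'k \<Rightarrow> 'm::ab_group_add \<Rightarrow> 'm"
    and lact :: "'a \<Rightarrow> 'm \<Rightarrow> 'm" and ract :: "'m \<Rightarrow> 'a \<Rightarrow> 'm"
    and S :: "'m \<Rightarrow> 'm"
  assumes "modified_rota_baxter_algebra scaleA mult R \<kappa>"
    and "modified_rota_baxter_bimodule scaleA mult R \<kappa> scaleM lact ract S"
  shows "modified_rota_baxter_algebra (module_prod.scale scaleA scaleM)
           (semidirect_mult mult lact ract) (map_prod R S) \<kappa>"
proof -
  interpret modified_rota_baxter_bimodule scaleA mult R \<kappa> scaleM lact ract S by fact
  \<comment> \<open>This makes \<open>P.scale\<close> the componentwise scalar multiplication and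
    supplies the vector space structure on the direct sum.\<close>
  interpret P: vector_space_prod scaleA scaleM by unfold_locales
  have mult_simps: "mult a (b + c) = mult a b + mult a c" "mult (a + b) c = mult a c + mult b c"
      "mult a (scaleA r b) = scaleA r (mult a b)" "mult (scaleA r a) b = scaleA r (mult a b)"
    for a b c r
    using A.mult_bilinear
    by (auto simp: bilinear_map_iff[OF A.vector_space_axioms A.vector_space_axioms A.vector_space_axioms])
  have lact_simps: "lact a (u + v) = lact a u + lact a v" "lact (a + b) u = lact a u + lact b u"
      "lact a (scaleM r u) = scaleM r (lact a u)" "lact (scaleA r a) u = scaleM r (lact a u)"
    for a b u v r
    using lact_bilinear
    by (auto simp: bilinear_map_iff[OF A.vector_space_axioms M.vector_space_axioms M.vector_space_axioms])
  have ract_simps: "ract u (a + b) = ract u a + ract u b" "ract (u + v) a = ract u a + ract v a"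
      "ract u (scaleA r a) = scaleM r (ract u a)" "ract (scaleM r u) a = scaleM r (ract u a)"
    for a b u v r
    using ract_bilinear
    by (auto simp: bilinear_map_iff[OF M.vector_space_axioms A.vector_space_axioms M.vector_space_axioms])
  have R_simps: "R (a + b) = R a + R b" "R (scaleA r a) = scaleA r (R a)" for a b r
    using A.R_linear by (auto simp: Vector_Spaces.linear_iff)
  have S_simps: "S (u + v) = S u + S v" "S (scaleM r u) = scaleM r (S u)" for u v r
    using S_linear by (auto simp: Vector_Spaces.linear_iff)
  note vs = P.p.vector_space_axioms
  show ?thesis
  proof (intro modified_rota_baxter_algebra.intro associative_algebra.intro vs
      associative_algebra_axioms.intro modified_rota_baxter_algebra_axioms.intro)
    show "bilinear_map P.scale P.scale P.scale (semidirect_mult mult lact ract)"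
      unfolding bilinear_map_iff[OF vs vs vs]
      by (auto simp: P.scale_def mult_simps lact_simps ract_simps M.scale_right_distrib)
    \<comment> \<open>In the second component both sides expand to a(bw) + a(vc) + (ub)c, in the
      same order, so \<open>add.assoc\<close> suffices.\<close>
    show "semidirect_mult mult lact ract (semidirect_mult mult lact ract x y) z =
        semidirect_mult mult lact ract x (semidirect_mult mult lact ract y z)" for x y z
      by (cases x; cases y; cases z)
        (simp add: A.mult_assoc lact_assoc ract_assoc lact_ract lact_simps ract_simps add.assoc)
    show "Vector_Spaces.linear P.scale P.scale (map_prod R S)"
      using vs by (auto simp: Vector_Spaces.linear_iff P.scale_def R_simps S_simps)
    \<comment> \<open>The second component is a sum of two actions: additivity of \<open>S\<close>
      separates its argument into the left and right parts, and \<open>M.scale_right_distrib\<close>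
      does the same for the \<kappa> term.\<close>
    show "semidirect_mult mult lact ract (map_prod R S x) (map_prod R S y) =
        map_prod R S (semidirect_mult mult lact ract (map_prod R S x) y +
          semidirect_mult mult lact ract x (map_prod R S y)) +
        P.scale \<kappa> (semidirect_mult mult lact ract x y)" for x y
      by (cases x; cases y)
        (simp add: P.scale_def A.modified_rota_baxter modified_rota_baxter_left
          modified_rota_baxter_right R_simps S_simps M.scale_right_distrib)
  qed
qed

end
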